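(* For every $\alpha\in\mathbb{R}$, $$\int_0^\infty\tanh (\pi x)\,\tanh(\alpha x)\,\cos(2\alpha x^2)\,dx=0 .$$
   Context: The integral is understood as a (conditionally convergent) improper Riemann integral $\lim_{R\to\infty}\int_0^R$. *)

theory Defs
  imports "HOL-Analysis.Analysis"
begin

end

theory Submission
  imports Defs "HOL-Real_Asymp.Real_Asymp"
begin

text \<open>
  Let \<open>\<alpha> = a > 0\<close>. Expanding only one factor by the sine transform
  \<open>tanh (pi x) = (a / pi) \<integral> sin (2 a x s) / sinh (a s) ds\<close> turns the integral over \<open>[-R, R]\<close> into a
  double integral of \<open>tanh (a x) sin (2 a x (s - x)) / sinh (a s)\<close>. Put \<open>y = s - x\<close>: the phase
  \<open>2 a x y\<close> is symmetric in \<open>x\<close> and \<open>y\<close>, so on the square \<open>\<bar>x\<bar>, \<bar>y\<bar> \<le> R\<close> the factor \<open>tanh (a x)\<close> may be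
  replaced by \<open>(tanh (a x) + tanh (a y)) / 2 = sinh (a s) / (2 cosh (a x) cosh (a y))\<close>. This cancels
  the denominator and leaves \<open>sin (2 a x y) / (2 cosh (a x) cosh (a y))\<close>, which is odd in \<open>x\<close> and
  integrates to 0. What remains is the part \<open>\<bar>x\<bar> \<le> R < \<bar>y\<bar>\<close>, which for fixed \<open>s\<close> is an
  oscillatory integral over an interval of length \<open>\<bar>s\<bar>\<close> near an endpoint of \<open>[-R, R]\<close>; it tends to 0 by dominated convergence.
\<close>

section \<open>The sine transform of \<open>1 / sinh\<close>\<close>

text \<open>The logarithmic derivative of the reflection formula of \<open>Gamma\<close> at \<open>1/2 + \<i> x\<close>.\<close>
lemma tanh_sums:
  fixes x :: real
  shows "(\<lambda>n. x / (x\<^sup>2 + (real n + 1/2)\<^sup>2)) sums (pi / 2 * tanh (pi * x))"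
proof -
  define z where "z = 1/2 + \<i> * of_real x"
  have Re: "Re z = 1/2" "Re (1 - z) = 1/2" by (simp_all add: z_def)
  have nonpos: "w \<notin> \<int>\<^sub>\<le>\<^sub>0" if "Re w = 1/2" for w :: complex
    using that by (auto elim!: nonpos_Ints_cases)
  \<comment> \<open>On the line \<open>Re z = 1/2\<close>, \<open>pi * z\<close> is
    \<open>pi/2 + \<i> * pi * x\<close>: the quarter-period shift swaps sine and cosine, and the
    imaginary part turns them hyperbolic.\<close>
  have cosh_eq: "sin (of_real pi * z) = of_real (cosh (pi * x))"
                "cos (of_real pi * z) = - \<i> * of_real (sinh (pi * x))"
  proof -
    have *: "of_real pi * z = of_real (pi/2) + \<i> * of_real (pi * x)"
      by (simp add: z_def algebra_simps)
    have cosh_eq: "cosh (of_real y :: complex) = of_real (cosh y)"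
      and sinh_eq: "sinh (of_real y :: complex) = of_real (sinh y)" for y
      by (simp_all add: cosh_def sinh_def scaleR_conv_of_real exp_of_real [symmetric])
    have s: "sin (of_real (pi/2)) = (1::complex)" "cos (of_real (pi/2)) = (0::complex)"
      unfolding sin_of_real cos_of_real by auto
    show "sin (of_real pi * z) = of_real (cosh (pi * x))"
      unfolding * sin_add s by (simp add: cos_conv_cosh cosh_eq sinh_eq del: of_real_mult)
    show "cos (of_real pi * z) = - \<i> * of_real (sinh (pi * x))"
      unfolding * cos_add s by (simp add: sin_conv_sinh cosh_eq sinh_eq del: of_real_mult)
  qed
  have sin_nz: "sin (of_real pi * z) \<noteq> 0"
    unfolding cosh_eq using cosh_real_pos[of "pi * x"] by (simp del: cosh_real_pos)
  have "((\<lambda>z. Gamma z * Gamma (1 - z)) has_field_derivative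
          Gamma z * Gamma (1 - z) * (Digamma z - Digamma (1 - z))) (at z)"
    using nonpos[OF Re(1)] nonpos[OF Re(2)]
    by (auto intro!: derivative_eq_intros simp: algebra_simps)
  moreover have "((\<lambda>z. of_real pi / sin (of_real pi * z)) has_field_derivative
          - of_real pi * (of_real pi * cos (of_real pi * z)) / (sin (of_real pi * z))\<^sup>2) (at z)"
    using sin_nz by (auto intro!: derivative_eq_intros simp: power2_eq_square)
  ultimately have "Gamma z * Gamma (1 - z) * (Digamma z - Digamma (1 - z)) =
      - of_real pi * (of_real pi * cos (of_real pi * z)) / (sin (of_real pi * z))\<^sup>2"
    unfolding Gamma_reflection_complex by (rule DERIV_unique)
  hence "Digamma z - Digamma (1 - z) = - of_real pi * cos (of_real pi * z) / sin (of_real pi * z)"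
  proof -
    have "D = - p * c / s" if "p / s * D = - p * (p * c) / s\<^sup>2" "p \<noteq> 0" "s \<noteq> 0" for p s c D :: complex
    proof -
      have "p / s * D = p / s * (- p * c / s)" using that(1) by (simp add: power2_eq_square)
      thus ?thesis using that(2,3) by (subst (asm) mult_cancel_left) auto
    qed
    from this[OF _ _ sin_nz] show ?thesis
      using \<open>_ = - of_real pi * _ / _\<close> unfolding Gamma_reflection_complex by simp
  qed
  also have "\<dots> = 2 * \<i> * of_real (pi / 2 * tanh (pi * x))"
    unfolding cosh_eq tanh_def by simp
  finally have Dig: "Digamma z - Digamma (1 - z) = 2 * \<i> * of_real (pi / 2 * tanh (pi * x))" .
  have sums: "(\<lambda>n. inverse (of_nat (Suc n)) - inverse (w + of_nat n)) sums (Digamma w + euler_mascheroni)"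
    if "Re w = 1/2" for w :: complex
  proof -
    have "w \<noteq> 0" using that by auto
    from summable_sums[OF summable_Digamma[OF this]] show ?thesis
      unfolding Digamma_def by simp
  qed
  \<comment> \<open>The two denominators are the conjugates \<open>n + 1/2 - \<i> x\<close> and
    \<open>n + 1/2 + \<i> x\<close>, so their reciprocals differ by a purely imaginary
    number.\<close>
  have eq: "inverse (1 - z + of_nat n) - inverse (z + of_nat n) =
          2 * \<i> * of_real (x / (x\<^sup>2 + (real n + 1/2)\<^sup>2))" for n
  proof -
    let ?m = "of_real (real n + 1/2) :: complex"
    have 1: "1 - z + of_nat n = ?m - \<i> * of_real x" "z + of_nat n = ?m + \<i> * of_real x"
      unfolding z_def by simp_all
    have nz: "?m - \<i> * of_real x \<noteq> 0" "?m + \<i> * of_real x \<noteq> 0"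
      by (auto simp: complex_eq_iff)
    have "(?m - \<i> * of_real x) * (?m + \<i> * of_real x) = of_real (x\<^sup>2 + (real n + 1/2)\<^sup>2)"
      by (simp add: algebra_simps power2_eq_square)
    thus ?thesis unfolding 1 using nz
      by (simp add: inverse_eq_divide diff_frac_eq)
  qed
  have "(\<lambda>n. inverse (1 - z + of_nat n) - inverse (z + of_nat n)) sums (Digamma z - Digamma (1 - z))"
    using sums_diff[OF sums[OF Re(1)] sums[OF Re(2)]] by (simp add: algebra_simps)
  hence "(\<lambda>n. 2 * \<i> * of_real (x / (x\<^sup>2 + (real n + 1/2)\<^sup>2))) sums
           (2 * \<i> * of_real (pi / 2 * tanh (pi * x)))"
    unfolding eq Dig .
  hence "(\<lambda>n. complex_of_real (x / (x\<^sup>2 + (real n + 1/2)\<^sup>2))) sums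
           of_real (pi / 2 * tanh (pi * x))"
    by (subst (asm) sums_mult_iff) auto
  thus ?thesis by (simp only: sums_of_real_iff)
qed

section \<open>Exponential majorants and the Laplace transform of the sine\<close>

lemma integrable_exp_neg_half_line:
  fixes k :: real
  assumes "k > 0"
  shows "integrable lborel (\<lambda>u. indicator {0..} u * exp (- k * u))"
proof (rule integrableI_nonneg)
  have "(\<integral>\<^sup>+u. ennreal (indicator {0..} u * exp (- k * u)) \<partial>lborel) =
        (\<integral>\<^sup>+u. ennreal (exp (- k * u)) * indicator {0..} u \<partial>lborel)"
    by (intro nn_integral_cong) (auto split: split_indicator)
  also have "\<dots> = ennreal (0 - (- exp (- k * 0) / k))"
  proof (rule nn_integral_FTC_atLeast)
    show "((\<lambda>u. - exp (- k * u) / k) \<longlongrightarrow> 0) at_top"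
      using assms by real_asymp
  qed (use assms in \<open>auto intro!: derivative_eq_intros\<close>)
  finally show "(\<integral>\<^sup>+u. ennreal (indicator {0..} u * exp (- k * u)) \<partial>lborel) < \<infinity>"
    by simp
qed auto

lemma integrable_exp_neg_abs:
  fixes k :: real
  assumes "k > 0"
  shows "integrable lborel (\<lambda>u. exp (- k * \<bar>u\<bar>))"
proof -
  have "integrable lborel (\<lambda>u. indicator {0..} u *\<^sub>R exp (- k * \<bar>u\<bar>))"
    using integrable_exp_neg_half_line[OF assms]
    by (rule Bochner_Integration.integrable_cong[THEN iffD1, rotated 2]) (auto split: split_indicator)
  from has_bochner_integral_even_function[OF has_bochner_integral_integrable[OF this]]
  show ?thesis by (auto simp: has_bochner_integral_iff)
qed

text \<open>The explicit antiderivative \<open>?F\<close> vanishes at infinity, so only its value at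
  0 contributes. These are the terms of the series for \<open>sin (c * u) / sinh u\<close>.\<close>

lemma integral_exp_sin:
  fixes k c :: real
  assumes "k > 0"
  shows "has_bochner_integral lborel (\<lambda>u. indicator {0..} u * (exp (- k * u) * sin (c * u)))
           (c / (k\<^sup>2 + c\<^sup>2))"
proof -
  let ?F = "\<lambda>u. - exp (- k * u) * (k * sin (c * u) + c * cos (c * u)) / (k\<^sup>2 + c\<^sup>2)"
  have pos: "k\<^sup>2 + c\<^sup>2 > 0" using assms by (simp add: add_pos_nonneg)
  have int: "integrable lborel (\<lambda>u. indicator {0..} u * (exp (- k * u) * sin (c * u)))"
    by (rule Bochner_Integration.integrable_bound[OF integrable_exp_neg_half_line[OF assms]])
       (auto split: split_indicator simp: abs_mult)
  have "(LBINT u=0..\<infinity>. exp (- k * u) * sin (c * u)) = 0 - ?F 0"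
  proof (rule interval_integral_FTC_integrable)
    show "(?F has_vector_derivative exp (- k * u) * sin (c * u)) (at u)" for u
      unfolding has_real_derivative_iff_has_vector_derivative[symmetric]
      using pos by (auto intro!: derivative_eq_intros simp: divide_simps)
                   algebra+
    \<comment> \<open>The open interval used by the fundamental theorem and \<open>{0..}\<close>
      differ only in the null set \<open>{0}\<close>.\<close>
    show "set_integrable lborel (einterval 0 \<infinity>) (\<lambda>u. exp (- k * u) * sin (c * u))"
      using int unfolding set_integrable_def
      by (rule integrable_discrete_difference[where X = "{0}", THEN iffD1, rotated 4])
         (auto simp: einterval_iff split: split_indicator)
    have "(?F \<longlongrightarrow> ?F 0) (at 0)"
      by (intro isContD continuous_intros) (use pos in auto)
    hence "(?F \<longlongrightarrow> ?F 0) (at_right 0)"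
      by (simp only: filterlim_at_split)
    thus "((?F \<circ> real_of_ereal) \<longlongrightarrow> ?F 0) (at_right 0)"
      unfolding zero_ereal_def ereal_tendsto_simps1 .
    have "(?F \<longlongrightarrow> 0) at_top"
    proof (rule Lim_null_comparison)
      show "\<forall>\<^sub>F u in at_top. norm (?F u) \<le> exp (- k * u) * ((k + \<bar>c\<bar>) / (k\<^sup>2 + c\<^sup>2))"
      proof (rule always_eventually, rule allI)
        fix u
        have "\<bar>k * sin (c * u) + c * cos (c * u)\<bar> \<le> \<bar>k * sin (c * u)\<bar> + \<bar>c * cos (c * u)\<bar>" by simp
        also have "\<dots> \<le> k * 1 + \<bar>c\<bar> * 1"
          unfolding abs_mult using assms by (intro add_mono mult_mono) auto
        finally show "norm (?F u) \<le> exp (- k * u) * ((k + \<bar>c\<bar>) / (k\<^sup>2 + c\<^sup>2))"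
          using pos by (simp add: abs_mult divide_right_mono mult_left_mono)
      qed
      show "((\<lambda>u. exp (- k * u) * ((k + \<bar>c\<bar>) / (k\<^sup>2 + c\<^sup>2))) \<longlongrightarrow> 0) at_top"
        using assms by (intro tendsto_mult_left_zero) real_asymp
    qed
    thus "((?F \<circ> real_of_ereal) \<longlongrightarrow> 0) (at_left \<infinity>)"
      unfolding ereal_tendsto_simps1 .
  qed auto
  hence "integral\<^sup>L lborel (\<lambda>u. indicator (einterval 0 \<infinity>) u * (exp (- k * u) * sin (c * u))) = c / (k\<^sup>2 + c\<^sup>2)"
    by (simp add: interval_lebesgue_integral_def set_lebesgue_integral_def)
  also have "integral\<^sup>L lborel (\<lambda>u. indicator (einterval 0 \<infinity>) u * (exp (- k * u) * sin (c * u))) =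
      integral\<^sup>L lborel (\<lambda>u. indicator {0..} u * (exp (- k * u) * sin (c * u)))"
    by (rule integral_discrete_difference[where X = "{0}"])
       (auto simp: einterval_iff split: split_indicator)
  finally show ?thesis using int by (simp add: has_bochner_integral_iff)
qed

text \<open>For \<open>u > 0\<close>, \<open>1 + u/2 \<le> exp (u/2)\<close> and
  \<open>exp (-3u/2) \<le> 1\<close> bound \<open>u/2\<close> by
  \<open>exp (u/2) - exp (-3u/2)\<close>, which equals \<open>2 exp (-u/2) sinh u\<close>. At
  \<open>u = 0\<close> the quotient is 0 by convention, and it is even in \<open>u\<close>.\<close>

lemma abs_div_sinh_le:
  fixes u :: real
  shows "\<bar>u / sinh u\<bar> \<le> 4 * exp (- (1/2) * \<bar>u\<bar>)"
proof -
  have pos: "u / sinh u \<le> 4 * exp (- (1/2) * u)" if "u > 0" for u :: real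
  proof -
    have "1 + u / 2 \<le> exp (u / 2)" by (rule exp_ge_add_one_self)
    moreover have "exp (- (3/2) * u) \<le> 1" using that by simp
    ultimately have "(1 + u / 2) - 1 \<le> exp (u / 2) - exp (- (3/2) * u)" by (rule diff_mono)
    hence "u \<le> 2 * (exp (u / 2) - exp (- (3/2) * u))" by simp
    also have "\<dots> = 4 * exp (- (1/2) * u) * sinh u"
      by (simp add: sinh_field_def algebra_simps diff_divide_distrib flip: exp_add)
    finally show ?thesis using that by (simp add: divide_le_eq)
  qed
  consider "u > 0" | "u = 0" | "- u > 0" by linarith
  thus ?thesis
    using pos[of u] pos[of "- u"] by cases auto
qed

lemma abs_sin_div_sinh_le:
  fixes c u :: real
  shows "\<bar>sin (c * u) / sinh u\<bar> \<le> 4 * \<bar>c\<bar> * exp (- (1/2) * \<bar>u\<bar>)"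
proof -
  have "\<bar>sin (c * u) / sinh u\<bar> \<le> \<bar>c * u\<bar> / \<bar>sinh u\<bar>"
    unfolding abs_divide by (intro divide_right_mono abs_sin_x_le_abs_x) auto
  also have "\<dots> = \<bar>c\<bar> * \<bar>u / sinh u\<bar>" by (simp add: abs_mult)
  also have "\<dots> \<le> \<bar>c\<bar> * (4 * exp (- (1/2) * \<bar>u\<bar>))"
    by (intro mult_left_mono abs_div_sinh_le) auto
  finally show ?thesis by (simp add: mult_ac)
qed

text \<open>Multiplying by \<open>sinh u\<close> makes the sum telescope. This is the geometric
  expansion of \<open>1 / sinh u\<close> with its exact remainder.\<close>

lemma sum_exp_odd_mult_sinh:
  fixes u :: real
  shows "(\<Sum>n<N. 2 * exp (- (2 * real n + 1) * u)) * sinh u = 1 - exp (- 2 * real N * u)"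
proof (induction N)
  case (Suc N)
  have "2 * exp (- (2 * real N + 1) * u) * sinh u = exp (- 2 * real N * u) - exp (- 2 * real (Suc N) * u)"
    by (simp add: sinh_field_def algebra_simps diff_divide_distrib flip: exp_add)
  with Suc show ?case by (simp add: algebra_simps)
qed auto

lemma measurable_sinh [measurable]: "(sinh :: real \<Rightarrow> real) \<in> borel_measurable borel"
  and measurable_cosh [measurable]: "(cosh :: real \<Rightarrow> real) \<in> borel_measurable borel"
  and measurable_tanh [measurable]: "(tanh :: real \<Rightarrow> real) \<in> borel_measurable borel"
  by (intro borel_measurable_continuous_onI continuous_intros; simp)+

text \<open>Expand \<open>1 / sinh u\<close> into exponentials on the half line and integrate term
  by term; the resulting series is the one in \<open>tanh_sums\<close> at
  \<open>c/2\<close>.\<close>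

lemma integral_sin_div_sinh:
  fixes c :: real
  shows "has_bochner_integral lborel (\<lambda>u. sin (c * u) / sinh u) (pi * tanh (pi * c / 2))"
proof -
  define h where "h = (\<lambda>u. indicator {0..} u * (sin (c * u) / sinh u))"
  define S where "S = (\<lambda>N u. \<Sum>n<N. 2 * (indicator {0..} u * (exp (- (2 * real n + 1) * u) * sin (c * u))))"
  have int: "integrable lborel (\<lambda>u. 4 * \<bar>c\<bar> * exp (- (1/2) * \<bar>u\<bar>))"
    by (intro integrable_mult_right integrable_exp_neg_abs) auto
  have "norm (h u) \<le> 4 * \<bar>c\<bar> * exp (- (1/2) * \<bar>u\<bar>)" for u
    using abs_sin_div_sinh_le[of c u] by (auto simp: h_def split: split_indicator)
  moreover have [measurable]: "h \<in> borel_measurable lborel"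
    unfolding h_def by measurable
  ultimately have int_h: "integrable lborel h"
    by (intro Bochner_Integration.integrable_bound[OF int]) auto
  \<comment> \<open>The exact remainder shows that every partial sum is dominated by its limit
    \<open>h\<close>, so \<open>norm (h u)\<close> serves as majorant.\<close>
  have S_eq: "S N u = h u * (1 - exp (- 2 * real N * u))" for N u
  proof (cases "u = 0")
    case False
    have "S N u = indicator {0..} u * sin (c * u) * (\<Sum>n<N. 2 * exp (- (2 * real n + 1) * u))"
      by (simp add: S_def sum_distrib_left mult_ac)
    also have "(\<Sum>n<N. 2 * exp (- (2 * real n + 1) * u)) = (1 - exp (- 2 * real N * u)) / sinh u"
      using sum_exp_odd_mult_sinh[of u N] False by (simp add: field_simps)
    finally show ?thesis by (simp add: h_def)
  qed (simp add: S_def h_def)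
  have S_int: "has_bochner_integral lborel (S N) (\<Sum>n<N. 2 * (c / ((2 * real n + 1)\<^sup>2 + c\<^sup>2)))" for N
    unfolding S_def
    by (intro has_bochner_integral_sum has_bochner_integral_mult_right integral_exp_sin) auto
  have "(\<lambda>N. integral\<^sup>L lborel (S N)) \<longlonglongrightarrow> integral\<^sup>L lborel h"
  proof (rule integral_dominated_convergence)
    show "integrable lborel (\<lambda>u. norm (h u))" using int_h by simp
    show "AE u in lborel. norm (S N u) \<le> norm (h u)" for N
    proof (rule AE_I2)
      fix u :: real
      show "norm (S N u) \<le> norm (h u)"
      proof (cases "u \<ge> 0")
        case True
        hence "\<bar>1 - exp (- 2 * real N * u)\<bar> \<le> 1" by simp
        thus ?thesis unfolding S_eq real_norm_def abs_mult by (rule mult_left_le) auto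
      qed (simp add: S_eq h_def)
    qed
    show "AE u in lborel. (\<lambda>N. S N u) \<longlonglongrightarrow> h u"
    proof (rule AE_I2)
      fix u :: real
      show "(\<lambda>N. S N u) \<longlonglongrightarrow> h u"
      proof (cases "u > 0")
        case True
        have "(\<lambda>N. h u * (1 - exp (- 2 * real N * u))) \<longlonglongrightarrow> h u * (1 - 0)"
          by (intro tendsto_intros) (use True in real_asymp)
        thus ?thesis by (simp add: S_eq)
      qed (simp add: S_eq h_def split: split_indicator)
    qed
    show "S N \<in> borel_measurable lborel" for N
      using S_int[of N] by (auto simp: has_bochner_integral_iff)
  qed auto
  hence "(\<lambda>n. 2 * (c / ((2 * real n + 1)\<^sup>2 + c\<^sup>2))) sums integral\<^sup>L lborel h"
    unfolding sums_def using S_int by (simp add: has_bochner_integral_iff)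
  moreover have "(\<lambda>n. 2 * (c / ((2 * real n + 1)\<^sup>2 + c\<^sup>2))) sums (pi / 2 * tanh (pi * (c / 2)))"
  proof -
    have "2 * (c / ((2 * real n + 1)\<^sup>2 + c\<^sup>2)) = (c/2) / ((c/2)\<^sup>2 + (real n + 1/2)\<^sup>2)" for n
    proof -
      have "(2 * real n + 1)\<^sup>2 + c\<^sup>2 = 4 * ((c/2)\<^sup>2 + (real n + 1/2)\<^sup>2)"
        by (simp add: power2_eq_square algebra_simps)
      moreover have "2 * (c / (4 * d)) = (c/2) / d" for d :: real by simp
      ultimately show ?thesis by (simp only:)
    qed
    thus ?thesis using tanh_sums[of "c/2"] by simp
  qed
  ultimately have "integral\<^sup>L lborel h = pi / 2 * tanh (pi * (c / 2))"
    by (rule sums_unique2)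
  hence "has_bochner_integral lborel (\<lambda>u. indicator {0..} u *\<^sub>R (sin (c * u) / sinh u)) (pi / 2 * tanh (pi * (c / 2)))"
    using int_h by (simp add: has_bochner_integral_iff h_def)
  \<comment> \<open>The integrand is even, so the whole line gives twice the half-line value
    \<open>pi/2 * tanh (pi * c/2)\<close>.\<close>
  from has_bochner_integral_even_function[OF this] show ?thesis by simp
qed

section \<open>Windowed, reflected and product integrals\<close>

lemma integrable_indicator_Icc [simp, intro]:
  fixes A C :: real
  shows "integrable lborel (indicat_real {A..C})"
  by (rule integrable_real_indicator) (auto simp: emeasure_lborel_Icc_eq)

lemma integrable_window:
  fixes f :: "real \<Rightarrow> real"
  assumes [measurable]: "f \<in> borel_measurable borel" and B: "\<And>x. \<bar>f x\<bar> \<le> B"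
  shows "integrable lborel (\<lambda>x. indicator {A..C} x * f x)"
proof (rule Bochner_Integration.integrable_bound)
  show "integrable lborel (\<lambda>x. B * indicator {A..C} x)" by simp
  show "AE x in lborel. norm (indicator {A..C} x * f x) \<le> norm (B * indicator {A..C} x)"
  proof (rule AE_I2)
    fix x
    have "\<bar>f x\<bar> \<le> \<bar>B\<bar>" using B[of x] by linarith
    thus "norm (indicator {A..C} x * f x) \<le> norm (B * indicator {A..C} x)"
      by (auto split: split_indicator)
  qed
qed auto

lemma integral_odd_eq_0:
  fixes f :: "real \<Rightarrow> real"
  assumes "\<And>x. f (- x) = - f x"
  shows "integral\<^sup>L lborel f = 0"
  using lborel_integral_real_affine[of "-1" f 0] assms by simp

lemma integral_reflect:
  fixes f :: "real \<Rightarrow> real"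
  shows "(\<integral>x. f (c - x) \<partial>lborel) = integral\<^sup>L lborel f"
  using lborel_integral_real_affine[of "-1" f c] by simp

text \<open>A product of two integrable functions of separate variables is integrable on the plane;
  this justifies both exchanges of integration order below.\<close>

lemma integrable_product_bound:
  fixes f :: "real \<times> real \<Rightarrow> real"
  assumes [measurable]: "f \<in> borel_measurable (lborel \<Otimes>\<^sub>M lborel)"
    and g: "integrable lborel g" and h: "integrable lborel h"
    and bound: "\<And>x y. \<bar>f (x, y)\<bar> \<le> g x * h y"
  shows "integrable (lborel \<Otimes>\<^sub>M lborel) f"
proof (rule Bochner_Integration.integrable_bound)
  have [measurable]: "g \<in> borel_measurable borel" "h \<in> borel_measurable borel"
    using g h by auto
  show "integrable (lborel \<Otimes>\<^sub>M lborel) (\<lambda>(x, y). g x * h y)"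
  proof (rule lborel_pair.Fubini_integrable)
    show "integrable lborel (\<lambda>x. \<integral>y. norm (case (x, y) of (x, y) \<Rightarrow> g x * h y) \<partial>lborel)"
      using g by (simp add: abs_mult)
    show "AE x in lborel. integrable lborel (\<lambda>y. case (x, y) of (x, y) \<Rightarrow> g x * h y)"
      using h by simp
  qed measurable
  show "AE p in lborel \<Otimes>\<^sub>M lborel. norm (f p) \<le> norm (case p of (x, y) \<Rightarrow> g x * h y)"
  proof (rule AE_I2)
    fix p :: "real \<times> real"
    show "norm (f p) \<le> norm (case p of (x, y) \<Rightarrow> g x * h y)"
      using bound[of "fst p" "snd p"] by (cases p) auto
  qed
qed auto

lemma has_bochner_integral_sin_div_sinh_scaled:
  fixes a x :: real
  assumes "a > 0"
  shows "has_bochner_integral lborel (\<lambda>s. sin (2 * a * x * s) / sinh (a * s)) (pi / a * tanh (pi * x))"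
  using integral_sin_div_sinh[of "2 * x"] assms
  by (subst (asm) lborel_has_bochner_integral_real_affine_iff[where c = a and t = 0])
     (simp_all add: field_simps)

section \<open>Splitting the double integral\<close>

text \<open>With \<open>y = s - x\<close>, the slice at \<open>s\<close> of the strip \<open>\<bar>x\<bar> \<le> R\<close> splits into the core \<open>\<bar>y\<bar> \<le> R\<close> and
  the tail \<open>\<bar>y\<bar> > R\<close>; \<open>core\<close> is already symmetrised and divided by \<open>sinh (a s) / 2\<close>.\<close>
definition slice :: "real \<Rightarrow> real \<Rightarrow> real \<Rightarrow> real" where
  "slice a R s = (\<integral>x. indicator {-R..R} x * (tanh (a * x) * sin (2 * a * x * (s - x))) \<partial>lborel)"

definition core :: "real \<Rightarrow> real \<Rightarrow> real \<Rightarrow> real" where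
  "core a R s = (\<integral>x. indicator {-R..R} x * (indicator {-R..R} (s - x) *
      (sin (2 * a * x * (s - x)) / (cosh (a * x) * cosh (a * (s - x))))) \<partial>lborel)"

definition tail :: "real \<Rightarrow> real \<Rightarrow> real \<Rightarrow> real" where
  "tail a R s = (\<integral>x. indicator {-R..R} x * ((1 - indicator {-R..R} (s - x)) *
      (tanh (a * x) * sin (2 * a * x * (s - x)))) \<partial>lborel)"

lemma abs_tanh_sin_le_1: "\<bar>tanh (y :: real) * sin z\<bar> \<le> 1"
proof -
  have "\<bar>tanh y\<bar> \<le> 1" using tanh_real_bounds[of y] by (auto simp: abs_le_iff)
  thus ?thesis using mult_mono[of "\<bar>tanh y\<bar>" 1 "\<bar>sin z\<bar>" 1] by (auto simp: abs_mult)
qed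

lemma tanh_add_tanh:
  fixes x y :: real
  shows "tanh x + tanh y = sinh (x + y) / (cosh x * cosh y)"
  by (simp add: tanh_def sinh_add add_frac_eq mult_ac)

text \<open>The reflection \<open>x \<mapsto> s - x\<close> swaps the two window indicators and
  fixes the phase, so on the square \<open>tanh (a * x)\<close> may be averaged with
  \<open>tanh (a * (s - x))\<close>; \<open>tanh_add_tanh\<close> then produces the factor
  \<open>sinh (a * s)\<close>.\<close>

lemma slice_eq_core_add_tail: "slice a R s = sinh (a * s) / 2 * core a R s + tail a R s"
proof -
  define k where "k = (\<lambda>x. indicator {-R..R} x * (indicator {-R..R} (s - x) *
      (tanh (a * x) * sin (2 * a * x * (s - x)))))"
  have int_k: "integrable lborel k"
    unfolding k_def
    by (rule integrable_window[where B = 1])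
       (use abs_tanh_sin_le_1 in \<open>auto split: split_indicator\<close>)
  have int_tail: "integrable lborel (\<lambda>x. indicator {-R..R} x * ((1 - indicator {-R..R} (s - x)) *
      (tanh (a * x) * sin (2 * a * x * (s - x)))))"
    by (rule integrable_window[where B = 1])
       (use abs_tanh_sin_le_1 in \<open>auto split: split_indicator\<close>)
  have "integral\<^sup>L lborel k + tail a R s = slice a R s"
    unfolding slice_def tail_def
    by (subst Bochner_Integration.integral_add[OF int_k int_tail, symmetric])
       (auto simp: k_def algebra_simps intro!: Bochner_Integration.integral_cong)
  moreover have "2 * integral\<^sup>L lborel k = sinh (a * s) * core a R s"
  proof -
    have "2 * integral\<^sup>L lborel k = integral\<^sup>L lborel k + (\<integral>x. k (s - x) \<partial>lborel)"
      by (simp add: integral_reflect)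
    also have "\<dots> = (\<integral>x. k x + k (s - x) \<partial>lborel)"
      using int_k lborel_integrable_real_affine[OF int_k, of "-1" s]
      by (intro Bochner_Integration.integral_add[symmetric]) auto
    also have "\<dots> = sinh (a * s) * core a R s"
      unfolding core_def integral_mult_right_zero[symmetric]
    proof (intro Bochner_Integration.integral_cong refl)
      fix x
      have "k x + k (s - x) = indicator {-R..R} x * (indicator {-R..R} (s - x) *
              ((tanh (a * x) + tanh (a * (s - x))) * sin (2 * a * x * (s - x))))"
        by (simp add: k_def algebra_simps)
      also have "tanh (a * x) + tanh (a * (s - x)) = sinh (a * s) / (cosh (a * x) * cosh (a * (s - x)))"
        unfolding tanh_add_tanh by (simp add: algebra_simps)
      finally show "k x + k (s - x) = sinh (a * s) * (indicator {-R..R} x * (indicator {-R..R} (s - x) *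
              (sin (2 * a * x * (s - x)) / (cosh (a * x) * cosh (a * (s - x))))))"
        by simp
    qed
    finally show ?thesis .
  qed
  ultimately show ?thesis by simp
qed

text \<open>By Fubini \<open>s\<close> may be integrated first; with \<open>s = x + y\<close> and
  \<open>x\<close> fixed, the integrand is odd in \<open>y\<close> on a symmetric window.\<close>

lemma has_bochner_integral_core: "has_bochner_integral lborel (core a R) 0"
proof -
  define f where "f = (\<lambda>x s. indicator {-R..R} x * (indicator {-R..R} (s - x) *
      (sin (2 * a * x * (s - x)) / (cosh (a * x) * cosh (a * (s - x))))) :: real)"
  have int: "integrable (lborel \<Otimes>\<^sub>M lborel) (case_prod f)"
  proof (rule integrable_product_bound)
    \<comment> \<open>If \<open>x\<close> and \<open>s - x\<close> both lie in
      \<open>{-R..R}\<close>, then \<open>s\<close> lies in \<open>{-2*R..2*R}\<close>.\<close>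
    show "integrable lborel (indicat_real {-R..R})" "integrable lborel (indicat_real {-2*R..2*R})"
      by auto
    fix x s
    have "\<bar>sin (2 * a * x * (s - x))\<bar> \<le> cosh (a * x) * cosh (a * (s - x))"
      using abs_sin_le_one[of "2 * a * x * (s - x)"] mult_mono[OF cosh_real_ge_1[of "a * x"] cosh_real_ge_1[of "a * (s - x)"]]
      by (simp del: abs_sin_le_one)
    hence "\<bar>sin (2 * a * x * (s - x)) / (cosh (a * x) * cosh (a * (s - x)))\<bar> \<le> 1"
      by (simp add: abs_mult)
    thus "\<bar>case_prod f (x, s)\<bar> \<le> indicat_real {-R..R} x * indicat_real {-2*R..2*R} s"
      by (auto simp: f_def split: split_indicator)
  next
    show "case_prod f \<in> borel_measurable (lborel \<Otimes>\<^sub>M lborel)"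
      unfolding f_def by measurable
  qed
  have "(\<integral>s. f x s \<partial>lborel) = 0" for x
  proof -
    have "(\<integral>s. f x s \<partial>lborel) = (\<integral>y. f x (x + y) \<partial>lborel)"
      using lborel_integral_real_affine[of 1 "f x" x] by simp
    also have "\<dots> = 0"
    proof (rule integral_odd_eq_0)
      have "indicator {-R..R} (- y) = (indicator {-R..R} y :: real)" for y
        by (auto split: split_indicator)
      thus "f x (x + - y) = - f x (x + y)" for y by (simp add: f_def)
    qed
    finally show ?thesis .
  qed
  hence "(\<integral>s. \<integral>x. f x s \<partial>lborel \<partial>lborel) = 0"
    by (subst lborel_pair.Fubini_integral[OF int]) simp
  with lborel_pair.integrable_snd[OF int] show ?thesis
    unfolding has_bochner_integral_iff core_def f_def by auto
qed

text \<open>Changing the signs of both \<open>x\<close> and \<open>s\<close> preserves the phase and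
  the windows but flips \<open>tanh (a * x)\<close>. Estimates of the tail thus reduce to
  \<open>s \<ge> 0\<close>.\<close>

lemma tail_minus: "tail a R (- s) = - tail a R s"
proof -
  have even: "indicator {-R..R} (- y) = (indicator {-R..R} y :: real)" for y
    by (auto split: split_indicator)
  have "indicator {-R..R} (- s - - x) = (indicator {-R..R} (s - x) :: real)" for x
    using even[of "s - x"] by simp
  hence "indicator {-R..R} (- x) * ((1 - indicator {-R..R} (- s - - x)) *
      (tanh (a * - x) * sin (2 * a * - x * (- s - - x)))) =
    - (indicator {-R..R} x * ((1 - indicator {-R..R} (s - x)) *
      (tanh (a * x) * sin (2 * a * x * (s - x)))))" for x
    unfolding even by (simp add: algebra_simps)
  with integral_reflect[of "\<lambda>x. indicator {-R..R} x * ((1 - indicator {-R..R} (- s - x)) *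
      (tanh (a * x) * sin (2 * a * x * (- s - x))))" 0]
  show ?thesis
    unfolding tail_def by simp
qed

text \<open>For \<open>s \<ge> 0\<close>, \<open>|x| \<le> R < |s - x|\<close> forces
  \<open>x < s - R\<close>, leaving an interval of length \<open>s\<close> with an integrand bounded
  by 1.\<close>

lemma abs_tail_le:
  assumes "R > 0"
  shows "\<bar>tail a R s\<bar> \<le> \<bar>s\<bar>"
proof -
  have pos: "\<bar>tail a R s\<bar> \<le> s" if "s \<ge> 0" for s
  proof -
    have "norm (tail a R s) \<le> (\<integral>x. indicator {-R..s-R} x \<partial>lborel)"
      unfolding tail_def
    proof (rule Bochner_Integration.integral_norm_bound_integral)
      show "integrable lborel (\<lambda>x. indicator {-R..R} x * ((1 - indicator {-R..R} (s - x)) *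
          (tanh (a * x) * sin (2 * a * x * (s - x)))))"
        by (rule integrable_window[where B = 1])
           (use abs_tanh_sin_le_1 in \<open>auto split: split_indicator\<close>)
      show "norm (indicator {-R..R} x * ((1 - indicator {-R..R} (s - x)) *
          (tanh (a * x) * sin (2 * a * x * (s - x))))) \<le> indicator {-R..s-R} x" for x
        using abs_tanh_sin_le_1[of "a * x" "2 * a * x * (s - x)"] that
        by (auto split: split_indicator)
    qed auto
    thus ?thesis using that by simp
  qed
  show ?thesis using pos[of s] pos[of "- s"] by (cases "s \<ge> 0") (auto simp: tail_minus)
qed

section \<open>Decay of the tail\<close>

text \<open>Integration by parts: the phase \<open>\<phi>\<close> has derivative \<open>d \<ge> 2 a R\<close> on the interval.\<close>
lemma abs_integral_sin_quadratic_le: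
  fixes a s R :: real
  assumes a: "a > 0" and s: "s > 0" and R: "R \<ge> s"
  shows "\<bar>\<integral>x. indicator {-R..s-R} x * sin (2 * a * x * (s - x)) \<partial>lborel\<bar> \<le> 1 / (a * R) + s / (a * R\<^sup>2)"
proof -
  define \<phi> where "\<phi> = (\<lambda>x. 2 * a * x * (s - x))"
  define d where "d = (\<lambda>x. 2 * a * (s - 2 * x))"
  define F where "F = (\<lambda>x. - cos (\<phi> x) / d x)"
  define E where "E = (\<lambda>x. 4 * a * cos (\<phi> x) / (d x)\<^sup>2)"
  \<comment> \<open>From \<open>x \<le> s - R\<close> and \<open>R \<ge> s\<close> follows
    \<open>s - 2 * x \<ge> 2 * R - s \<ge> R\<close>.\<close>
  have d_ge: "d x \<ge> 2 * a * R" if "x \<in> {-R..s-R}" for x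
    unfolding d_def using that a s R by (intro mult_left_mono) auto
  have d_pos: "d x > 0" if "x \<in> {-R..s-R}" for x
    using d_ge[OF that] mult_pos_pos[of "2 * a" R] a s R by linarith
  have "(\<phi> has_real_derivative d x) (at x within A)" for x A
    unfolding \<phi>_def d_def by (auto intro!: derivative_eq_intros simp: algebra_simps)
  note [derivative_intros] = DERIV_chain2[OF this]
  have "(d has_real_derivative - 4 * a) (at x within A)" for x A
    unfolding d_def by (auto intro!: derivative_eq_intros)
  note [derivative_intros] = DERIV_chain2[OF this]
  have cont_d: "continuous_on {-R..s-R} d"
    unfolding d_def by (intro continuous_intros)
  have cont_E: "continuous_on {-R..s-R} E"
    unfolding E_def \<phi>_def by (intro continuous_intros cont_d) (use d_pos in force)
  \<comment> \<open>Differentiating \<open>F\<close> gives \<open>sin (\<phi> x)\<close> plus the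
    term from the derivative \<open>- 4 * a\<close> of \<open>d\<close>, which is
    \<open>- E x\<close>.\<close>
  have "((\<lambda>x. sin (\<phi> x) - E x) has_integral F (s - R) - F (- R)) {-R..s-R}"
  proof (rule fundamental_theorem_of_calculus)
    fix x assume x: "x \<in> {-R..s-R}"
    show "(F has_vector_derivative sin (\<phi> x) - E x) (at x within {-R..s-R})"
      unfolding has_real_derivative_iff_has_vector_derivative[symmetric] F_def E_def
      using d_pos[OF x]
      by (auto intro!: derivative_eq_intros simp: power2_eq_square diff_divide_distrib)
  qed (use s in auto)
  moreover have "(E has_integral integral {-R..s-R} E) {-R..s-R}"
    by (intro integrable_integral integrable_continuous_interval cont_E)
  ultimately have "((\<lambda>x. sin (\<phi> x)) has_integral F (s - R) - F (- R) + integral {-R..s-R} E) {-R..s-R}"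
    by (rule has_integral_add[THEN has_integral_eq_rhs, THEN has_integral_eq[rotated]]) auto
  moreover have "set_integrable lborel {-R..s-R} (\<lambda>x. sin (\<phi> x))"
    unfolding \<phi>_def by (intro borel_integrable_atLeastAtMost' continuous_intros)
  ultimately have eq: "(\<integral>x. indicator {-R..s-R} x * sin (\<phi> x) \<partial>lborel) =
      F (s - R) - F (- R) + integral {-R..s-R} E"
    using set_borel_integral_eq_integral(2)[of "{-R..s-R}" "\<lambda>x. sin (\<phi> x)"]
    by (simp add: set_lebesgue_integral_def integral_unique)
  have F_le: "\<bar>F x\<bar> \<le> 1 / (2 * a * R)" if "x \<in> {-R..s-R}" for x
    unfolding F_def abs_divide abs_minus_cancel
    using d_pos[OF that] d_ge[OF that] a s R by (intro frac_le) auto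
  \<comment> \<open>Here \<open>d x \<ge> 2 * a * R\<close> gives
    \<open>4 * a / (2 * a * R)\<^sup>2 = 1 / (a * R\<^sup>2)\<close>, times the length
    \<open>s\<close>.\<close>
  have "norm (integral {-R..s-R} E) \<le> 1 / (a * R\<^sup>2) * (s - R - - R)"
  proof (rule integral_bound)
    fix x assume x: "x \<in> {-R..s-R}"
    have "\<bar>E x\<bar> \<le> 4 * a / (2 * a * R)\<^sup>2"
      unfolding E_def abs_divide abs_mult
      using d_pos[OF x] d_ge[OF x] a s R by (intro frac_le power_mono) auto
    also have "\<dots> = 1 / (a * R\<^sup>2)"
      using a by (simp add: power2_eq_square)
    finally show "norm (E x) \<le> 1 / (a * R\<^sup>2)" by simp
  next
    show "continuous_on {-R..s-R} E"
      by (rule cont_E)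
  qed (use a s in auto)
  hence "\<bar>integral {-R..s-R} E\<bar> \<le> s / (a * R\<^sup>2)" using s by simp
  moreover have "\<bar>F (s - R)\<bar> + \<bar>F (- R)\<bar> \<le> 1 / (a * R)"
    using F_le[of "s - R"] F_le[of "- R"] s by (simp add: field_simps)
  ultimately show ?thesis
    using eq unfolding \<phi>_def by linarith
qed

text \<open>For \<open>s > 0\<close> the interval \<open>[-R, s - R]\<close> moves to minus
  infinity, where \<open>tanh (a * x)\<close> tends to -1. Writing \<open>tanh\<close> as
  \<open>(tanh + 1) - 1\<close> leaves a uniformly small part and a pure oscillatory
  integral.\<close>

lemma tail_tendsto_0:
  assumes a: "a > 0"
  shows "((\<lambda>R. tail a R s) \<longlongrightarrow> 0) at_top"
proof -
  have pos: "((\<lambda>R. tail a R s) \<longlongrightarrow> 0) at_top" if s: "s > 0" for s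
  proof (rule Lim_null_comparison)
    show "\<forall>\<^sub>F R in at_top. norm (tail a R s) \<le>
            s * (tanh (a * (s - R)) + 1) + (1 / (a * R) + s / (a * R\<^sup>2))"
      using eventually_ge_at_top[of s]
    proof eventually_elim
      case (elim R)
      define w where "w = (\<lambda>x. (tanh (a * x) + 1) * sin (2 * a * x * (s - x)))"
      have w_le: "\<bar>w x\<bar> \<le> tanh (a * x) + 1" for x
        using tanh_real_bounds[of "a * x"] unfolding w_def abs_mult
        by (auto intro!: mult_left_le)
      have int_w: "integrable lborel (\<lambda>x. indicator {-R..s-R} x * w x)"
      proof (rule integrable_window)
        show "\<bar>w x\<bar> \<le> 2" for x
          using w_le[of x] tanh_real_lt_1[of "a * x"] by linarith
      qed (simp add: w_def)
      have int_sin: "integrable lborel (\<lambda>x. indicator {-R..s-R} x * sin (2 * a * x * (s - x)))"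
        by (rule integrable_window[where B = 1]) auto
      \<comment> \<open>The tail region is half-open: at \<open>x = s - R\<close> the point
        \<open>s - x = R\<close> still belongs to the core, hence the discarded singleton.\<close>
      have "tail a R s = (\<integral>x. indicator {-R..s-R} x * w x - indicator {-R..s-R} x * sin (2 * a * x * (s - x)) \<partial>lborel)"
        unfolding tail_def w_def using s elim
        by (intro integral_discrete_difference[where X = "{s - R}"])
           (auto simp: algebra_simps split: split_indicator)
      also have "\<dots> = (\<integral>x. indicator {-R..s-R} x * w x \<partial>lborel) -
          (\<integral>x. indicator {-R..s-R} x * sin (2 * a * x * (s - x)) \<partial>lborel)"
        using int_w int_sin by (rule Bochner_Integration.integral_diff)
      finally have "\<bar>tail a R s\<bar> \<le> \<bar>\<integral>x. indicator {-R..s-R} x * w x \<partial>lborel\<bar> +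
          \<bar>\<integral>x. indicator {-R..s-R} x * sin (2 * a * x * (s - x)) \<partial>lborel\<bar>"
        by linarith
      moreover have "norm (\<integral>x. indicator {-R..s-R} x * w x \<partial>lborel) \<le>
          (\<integral>x. (tanh (a * (s - R)) + 1) * indicator {-R..s-R} x \<partial>lborel)"
      proof (rule Bochner_Integration.integral_norm_bound_integral)
        fix x
        \<comment> \<open>As \<open>tanh\<close> is increasing and \<open>a > 0\<close>, the right
          endpoint gives the bound.\<close>
        have "\<bar>w x\<bar> \<le> tanh (a * (s - R)) + 1" if "x \<le> s - R"
          using w_le[of x] that a by (smt (verit) mult_left_mono tanh_real_le_iff)
        thus "norm (indicator {-R..s-R} x * w x) \<le> (tanh (a * (s - R)) + 1) * indicator {-R..s-R} x"
          by (auto split: split_indicator)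
      qed (use int_w in auto)
      ultimately show ?case
        using abs_integral_sin_quadratic_le[OF a s elim] s by (simp add: mult.commute)
    qed
    have "filterlim (\<lambda>R. a * (s - R)) at_bot at_top"
      using a by real_asymp
    from filterlim_compose[OF tanh_real_at_bot this]
    have lim: "((\<lambda>R. tanh (a * (s - R))) \<longlongrightarrow> -1) at_top" .
    have "((\<lambda>R. 1 / (a * R) + s / (a * R\<^sup>2)) \<longlongrightarrow> 0) at_top"
      using a s by real_asymp
    hence "((\<lambda>R. s * (tanh (a * (s - R)) + 1) + (1 / (a * R) + s / (a * R\<^sup>2))) \<longlongrightarrow> s * (-1 + 1) + 0) at_top"
      by (intro tendsto_intros lim)
    thus "((\<lambda>R. s * (tanh (a * (s - R)) + 1) + (1 / (a * R) + s / (a * R\<^sup>2))) \<longlongrightarrow> 0) at_top"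
      by simp
  qed
  consider "s > 0" | "s = 0" | "- s > 0" by linarith
  thus ?thesis
  proof cases
    case 2
    have "tail a R 0 = 0" for R using tail_minus[of a R 0] by simp
    thus ?thesis using 2 by simp
  next
    case 3
    from tendsto_minus[OF pos[OF this]] show ?thesis by (simp add: tail_minus)
  qed (use pos in auto)
qed

lemma measurable_tail [measurable]: "tail a R \<in> borel_measurable borel"
  unfolding tail_def by measurable

text \<open>The linear bound on the tail cancels the pole of \<open>1 / sinh (a * s)\<close> at 0,
  giving an integrable majorant independent of \<open>R\<close>.\<close>

lemma abs_tail_div_sinh_le:
  assumes a: "a > 0" and R: "R > 0"
  shows "\<bar>tail a R s / sinh (a * s)\<bar> \<le> 4 / a * exp (- (a/2) * \<bar>s\<bar>)"
proof -
  have "\<bar>tail a R s / sinh (a * s)\<bar> \<le> \<bar>s\<bar> / \<bar>sinh (a * s)\<bar>"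
    unfolding abs_divide by (intro divide_right_mono abs_tail_le R) auto
  also have "\<dots> = 1 / a * \<bar>a * s / sinh (a * s)\<bar>"
    using a by (simp add: abs_mult)
  also have "\<dots> \<le> 1 / a * (4 * exp (- (1/2) * \<bar>a * s\<bar>))"
    using a by (intro mult_left_mono abs_div_sinh_le) auto
  finally show ?thesis using a by (simp add: abs_mult)
qed

lemma integrable_tail_div_sinh:
  assumes a: "a > 0" and R: "R > 0"
  shows "integrable lborel (\<lambda>s. tail a R s / sinh (a * s))"
proof (rule Bochner_Integration.integrable_bound)
  show "integrable lborel (\<lambda>s. 4 / a * exp (- (a/2) * \<bar>s\<bar>))"
    using a by (intro integrable_mult_right integrable_exp_neg_abs) auto
  show "AE s in lborel. norm (tail a R s / sinh (a * s)) \<le> norm (4 / a * exp (- (a/2) * \<bar>s\<bar>))"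
    using abs_tail_div_sinh_le[OF a R] a by (auto simp del: abs_divide)
qed measurable

section \<open>The integral over a finite window\<close>

text \<open>Expanding the sine of \<open>2 a x s - 2 a x\<^sup>2\<close>, the term with
  \<open>sin (2 * a * x\<^sup>2)\<close> is odd in \<open>x\<close> and drops out.\<close>

lemma slice_eq:
  "slice a R s = (\<integral>x. indicator {-R..R} x * (tanh (a * x) * cos (2 * a * x\<^sup>2) * sin (2 * a * x * s)) \<partial>lborel)"
proof -
  define f where "f = (\<lambda>x. indicator {-R..R} x * (tanh (a * x) * (cos (2 * a * x\<^sup>2) * sin (2 * a * x * s))))"
  define g where "g = (\<lambda>x. indicator {-R..R} x * (tanh (a * x) * (sin (2 * a * x\<^sup>2) * cos (2 * a * x * s))))"
  have int_f: "integrable lborel f" unfolding f_def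
  proof (rule integrable_window[where B = 1])
    show "\<bar>tanh (a * x) * (cos (2 * a * x\<^sup>2) * sin (2 * a * x * s))\<bar> \<le> 1" for x
      using abs_tanh_sin_le_1[of "a * x" "2 * a * x * s"] abs_cos_le_one[of "2 * a * x\<^sup>2"]
        mult_mono[of "\<bar>tanh (a * x) * sin (2 * a * x * s)\<bar>" 1 "\<bar>cos (2 * a * x\<^sup>2)\<bar>" 1]
      by (simp add: abs_mult mult_ac)
  qed measurable
  have int_g: "integrable lborel g" unfolding g_def
  proof (rule integrable_window[where B = 1])
    show "\<bar>tanh (a * x) * (sin (2 * a * x\<^sup>2) * cos (2 * a * x * s))\<bar> \<le> 1" for x
      using abs_tanh_sin_le_1[of "a * x" "2 * a * x\<^sup>2"] abs_cos_le_one[of "2 * a * x * s"]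
        mult_mono[of "\<bar>tanh (a * x) * sin (2 * a * x\<^sup>2)\<bar>" 1 "\<bar>cos (2 * a * x * s)\<bar>" 1]
      by (simp add: abs_mult mult_ac)
  qed measurable
  have "indicator {-R..R} (- x) = (indicator {-R..R} x :: real)" for x
    by (auto split: split_indicator)
  hence "integral\<^sup>L lborel g = 0"
    by (intro integral_odd_eq_0) (simp add: g_def)
  moreover have "slice a R s = (\<integral>x. f x - g x \<partial>lborel)"
    unfolding slice_def
  proof (intro Bochner_Integration.integral_cong refl)
    fix x
    have "2 * a * x * (s - x) = 2 * a * x * s - 2 * a * x\<^sup>2"
      by (simp add: algebra_simps power2_eq_square)
    thus "indicator {-R..R} x * (tanh (a * x) * sin (2 * a * x * (s - x))) = f x - g x"
      by (simp only: sin_diff f_def g_def) (simp add: algebra_simps)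
  qed
  ultimately have "slice a R s = integral\<^sup>L lborel f"
    using int_f int_g by simp
  thus ?thesis by (simp add: f_def mult_ac)
qed

text \<open>Replace \<open>tanh (pi * x)\<close> by its sine integral over \<open>s\<close> and
  exchange the order of integration.\<close>

lemma integral_window_eq_slice:
  assumes a: "a > 0"
  shows "(\<integral>x. indicator {-R..R} x * (tanh (pi * x) * tanh (a * x) * cos (2 * a * x\<^sup>2)) \<partial>lborel) =
           a / pi * (\<integral>s. slice a R s / sinh (a * s) \<partial>lborel)"
proof -
  define f where "f = (\<lambda>x s. indicator {-R..R} x * (tanh (a * x) * cos (2 * a * x\<^sup>2) *
                           (sin (2 * a * x * s) / sinh (a * s))) :: real)"
  have "integrable (lborel \<Otimes>\<^sub>M lborel) (case_prod f)"
  proof (rule integrable_product_bound[where g = "indicat_real {-R..R}" and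
        \<comment> \<open>The constant is \<open>4 * |c|\<close> from
          \<open>abs_sin_div_sinh_le\<close> at \<open>c = 2 * x\<close>, with
          \<open>|x| \<le> R\<close>.\<close>
        h = "\<lambda>s. 8 * R * exp (- (a/2) * \<bar>s\<bar>)"])
    show "case_prod f \<in> borel_measurable (lborel \<Otimes>\<^sub>M lborel)"
      unfolding f_def by measurable
    show "integrable lborel (\<lambda>s. 8 * R * exp (- (a/2) * \<bar>s\<bar>))"
      using a by (intro integrable_mult_right integrable_exp_neg_abs) auto
    fix x s
    have "\<bar>tanh (a * x) * cos (2 * a * x\<^sup>2)\<bar> \<le> 1"
      using abs_tanh_sin_le_1[of "a * x" "pi/2 - 2 * a * x\<^sup>2"] by (simp add: sin_cos_eq)
    moreover have "\<bar>sin (2 * a * x * s) / sinh (a * s)\<bar> \<le> 8 * \<bar>x\<bar> * exp (- (a/2) * \<bar>s\<bar>)"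
      using abs_sin_div_sinh_le[of "2 * x" "a * s"] a by (simp add: abs_mult mult_ac)
    ultimately have *: "\<bar>tanh (a * x) * cos (2 * a * x\<^sup>2) * (sin (2 * a * x * s) / sinh (a * s))\<bar> \<le>
        1 * (8 * \<bar>x\<bar> * exp (- (a/2) * \<bar>s\<bar>))"
      unfolding abs_mult[of "tanh (a * x) * cos (2 * a * x\<^sup>2)"] by (intro mult_mono) auto
    show "\<bar>case_prod f (x, s)\<bar> \<le> indicat_real {-R..R} x * (8 * R * exp (- (a/2) * \<bar>s\<bar>))"
    proof (cases "x \<in> {-R..R}")
      case True
      hence "8 * \<bar>x\<bar> * exp (- (a/2) * \<bar>s\<bar>) \<le> 8 * R * exp (- (a/2) * \<bar>s\<bar>)"
        by (intro mult_right_mono) auto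
      with * have "\<bar>tanh (a * x) * cos (2 * a * x\<^sup>2) * (sin (2 * a * x * s) / sinh (a * s))\<bar> \<le>
          8 * R * exp (- (a/2) * \<bar>s\<bar>)"
        by linarith
      with True show ?thesis by (simp add: f_def)
    qed (simp add: f_def)
  qed auto
  from lborel_pair.Fubini_integral[OF this]
  have "(\<integral>s. \<integral>x. f x s \<partial>lborel \<partial>lborel) = (\<integral>x. \<integral>s. f x s \<partial>lborel \<partial>lborel)" .
  moreover have "(\<integral>x. f x s \<partial>lborel) = slice a R s / sinh (a * s)" for s
    unfolding slice_eq integral_divide_zero[symmetric] f_def
    by (intro Bochner_Integration.integral_cong) auto
  moreover have "(\<integral>s. f x s \<partial>lborel) =
      pi / a * (indicator {-R..R} x * (tanh (pi * x) * tanh (a * x) * cos (2 * a * x\<^sup>2)))" for x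
    using has_bochner_integral_sin_div_sinh_scaled[OF a, of x]
    unfolding f_def integral_mult_right_zero by (simp add: has_bochner_integral_iff mult_ac)
  ultimately show ?thesis using a by simp
qed

lemma integral_window_eq_tail:
  assumes a: "a > 0" and R: "R > 0"
  shows "(\<integral>x. indicator {-R..R} x * (tanh (pi * x) * tanh (a * x) * cos (2 * a * x\<^sup>2)) \<partial>lborel) =
           a / pi * (\<integral>s. tail a R s / sinh (a * s) \<partial>lborel)"
proof -
  have "integral\<^sup>L lborel (\<lambda>s. slice a R s / sinh (a * s)) =
          integral\<^sup>L lborel (\<lambda>s. core a R s / 2 + tail a R s / sinh (a * s))"
    \<comment> \<open>Cancelling \<open>sinh (a * s)\<close> against the core fails only at
      \<open>s = 0\<close>, where the quotients are 0 by convention.\<close>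
    by (rule integral_discrete_difference[where X = "{0}"])
       (use a in \<open>auto simp: slice_eq_core_add_tail add_divide_distrib\<close>)
  also have "\<dots> = integral\<^sup>L lborel (\<lambda>s. tail a R s / sinh (a * s))"
  proof (subst Bochner_Integration.integral_add)
    show "integrable lborel (\<lambda>s. core a R s / 2)"
      using has_bochner_integral_core[of a R] by (simp add: has_bochner_integral_iff)
    show "integrable lborel (\<lambda>s. tail a R s / sinh (a * s))"
      by (rule integrable_tail_div_sinh[OF a R])
  qed (use has_bochner_integral_core[of a R] in \<open>simp add: has_bochner_integral_iff\<close>)
  finally show ?thesis unfolding integral_window_eq_slice[OF a] by simp
qed

section \<open>Passage to the limit for positive parameter\<close>

lemma integral_tanh_tanh_cos_tendsto_0:
  fixes a :: real
  assumes a: "a > 0"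
  shows "((\<lambda>R. integral {0..R} (\<lambda>x. tanh (pi * x) * tanh (a * x) * cos (2 * a * x\<^sup>2))) \<longlongrightarrow> 0) at_top"
proof -
  let ?f = "\<lambda>x. tanh (pi * x) * tanh (a * x) * cos (2 * a * x\<^sup>2)"
  have "((\<lambda>R. \<integral>s. tail a R s / sinh (a * s) \<partial>lborel) \<longlongrightarrow> (\<integral>s. 0 \<partial>(lborel :: real measure))) at_top"
  proof (rule integral_dominated_convergence_at_top)
    show "integrable lborel (\<lambda>s. 4 / a * exp (- (a/2) * \<bar>s\<bar>))"
      using a by (intro integrable_mult_right integrable_exp_neg_abs) auto
    show "AE s in lborel. ((\<lambda>R. tail a R s / sinh (a * s)) \<longlongrightarrow> 0) at_top"
      by (intro AE_I2 tendsto_divide_zero tail_tendsto_0 a)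
    show "\<forall>\<^sub>F R in at_top. AE s in lborel. norm (tail a R s / sinh (a * s)) \<le> 4 / a * exp (- (a/2) * \<bar>s\<bar>)"
      using eventually_gt_at_top[of 0]
      by eventually_elim (use abs_tail_div_sinh_le[OF a] in auto)
    show "(\<lambda>s. tail a R s / sinh (a * s)) \<in> borel_measurable lborel" for R
      by measurable
  qed auto
  \<comment> \<open>The window identity concerns \<open>[-R, R]\<close>; the integrand is even, so
    half of it is the integral over \<open>[0, R]\<close>.\<close>
  hence "((\<lambda>R. a / pi * (\<integral>s. tail a R s / sinh (a * s) \<partial>lborel) / 2) \<longlongrightarrow> a / pi * 0 / 2) at_top"
    by (intro tendsto_intros) auto
  moreover have "\<forall>\<^sub>F R in at_top. a / pi * (\<integral>s. tail a R s / sinh (a * s) \<partial>lborel) / 2 = integral {0..R} ?f"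
    using eventually_gt_at_top[of 0]
  proof eventually_elim
    case (elim R)
    have cont: "continuous_on {0..R} ?f"
      by (intro continuous_intros) auto
    have int: "integrable lborel (\<lambda>x. indicator {0..R} x *\<^sub>R ?f x)"
      using borel_integrable_atLeastAtMost'[OF cont] by (simp add: set_integrable_def)
    moreover have "(\<integral>x. indicator {0..R} x *\<^sub>R ?f x \<partial>lborel) = integral {0..R} ?f"
      using set_borel_integral_eq_integral(2)[OF borel_integrable_atLeastAtMost'[OF cont]]
      by (simp add: set_lebesgue_integral_def)
    moreover have "(\<lambda>x. indicator {0..R} x *\<^sub>R ?f x) = (\<lambda>x. indicator {0..} x *\<^sub>R (indicator {-R..R} x * ?f x))"
      by (auto simp: fun_eq_iff split: split_indicator)
    ultimately have "has_bochner_integral lborel (\<lambda>x. indicator {0..} x *\<^sub>R (indicator {-R..R} x * ?f x)) (integral {0..R} ?f)"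
      by (simp add: has_bochner_integral_iff)
    moreover have "indicator {-R..R} (- x) = (indicator {-R..R} x :: real)" for x
      by (auto split: split_indicator)
    ultimately have "has_bochner_integral lborel (\<lambda>x. indicator {-R..R} x * ?f x) (2 *\<^sub>R integral {0..R} ?f)"
      by (intro has_bochner_integral_even_function) auto
    thus ?case using integral_window_eq_tail[OF a elim] by (simp add: has_bochner_integral_iff)
  qed
  ultimately show ?thesis by (simp cong: filterlim_cong add: tendsto_cong)
qed

theorem mainTheorem4:
  fixes \<alpha> :: real
  shows "((\<lambda>R :: real. integral {0..R}
            (\<lambda>x :: real. tanh (pi * x) * tanh (\<alpha> * x) * cos (2 * \<alpha> * x\<^sup>2)))
          \<longlongrightarrow> 0) at_top"
proof -
  consider "\<alpha> > 0" | "\<alpha> = 0" | "- \<alpha> > 0" by linarith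
  thus ?thesis
  proof cases
    case 3
    \<comment> \<open>The integrand is odd in the parameter, so the negative case follows from the
      positive one.\<close>
    have "tanh (pi * x) * tanh (- \<alpha> * x) * cos (2 * (- \<alpha>) * x\<^sup>2) =
          - (tanh (pi * x) * tanh (\<alpha> * x) * cos (2 * \<alpha> * x\<^sup>2))" for x
      by simp
    with tendsto_minus[OF integral_tanh_tanh_cos_tendsto_0[OF 3]] show ?thesis
      by (simp only: integral_neg minus_minus minus_zero)
  qed (use integral_tanh_tanh_cos_tendsto_0 in simp_all)
qed

end
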